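(* Let $\mathcal{A}=(a_{i_1i_2\cdots i_m})$ be an order $m$ dimension $n$ nonnegative weakly irreducible tensor, and let $g$ be the girth of $G_{\mathcal{A}}$. For a positive diagonal matrix $X$, let $K_{(1)}(X)\leqslant K_{(2)}(X)\leqslant\cdots\leqslant K_{(n)}(X)$ denote the slice sums of the tensor $X^{-(m-1)}\mathcal{A}X$ arranged in nondecreasing order. Then \[ \min_{X\in D^n}\Big(\prod_{i=n-g+1}^n K_{(i)}(X)\Big)^{\frac{1}{g}}=\rho(\mathcal{A})=\max_{X\in D^n}\Big(\prod_{i=1}^g K_{(i)}(X)\Big)^{\frac{1}{g}}, \] where $D^n$ is the set of all $n\times n$ diagonal matrices with positive diagonal entries.
   Context: For an invertible diagonal matrix $X=\mathrm{diag}(x_1,\ldots,x_n)$, $X^{-(m-1)}\mathcal{A}X$ is the order $m$ dimension $n$ tensor with entries $x_{i_1}^{-(m-1)}a_{i_1i_2\cdots i_m}x_{i_2}\cdots x_{i_m}$. The slice sums of an order $m$ dimension $n$ tensor $\mathcal{B}=(b_{i_1\cdots i_m})$ are $K_i(\mathcal{B})=\sum_{i_2,\ldots,i_m=1}^n b_{ii_2\cdots i_m}$, $i=1,\ldots,n$. $(\mathcal{A}x^{m-1})_i=\sum_{i_2,\ldots,i_m}a_{ii_2\cdots i_m}x_{i_2}\cdots x_{i_m}$; $\lambda\in\mathbb{C}$ is an eigenvalue of $\mathcal{A}$ if $\mathcal{A}x^{m-1}=\lambda(x_1^{m-1},\ldots,x_n^{m-1})^{\mathrm T}$ for some nonzero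 $x\in\mathbb{C}^n$; $\rho(\mathcal{A})$ is the maximum modulus of eigenvalues. The digraph $G_{\mathcal{A}}$ has vertices $\{1,\ldots,n\}$ and an arc $(i,j)$ whenever $a_{ii_2\cdots i_m}\neq0$ for some $i_2,\ldots,i_m$ with $j\in\{i_2,\ldots,i_m\}$ (loops allowed); $\mathcal{A}$ is weakly irreducible if $G_{\mathcal{A}}$ is strongly connected. A circuit is a directed closed path $i_1\to\cdots\to i_p\to i_1$ with $i_1,\ldots,i_p$ distinct (a loop is a circuit of length 1); the girth is the shortest length of a circuit. *)

theory Defs
  imports
    "HOL-Analysis.Analysis"
    "HOL-Library.Multiset"
    "HOL-Library.Extended_Nat"
    "Graph_Theory.Digraph_Component"
begin

text \<open>
  A tensor of order \<open>m\<close> and dimension \<open>n = CARD('n)\<close> is represented by its entry function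
  on multi-indices, which are lists over \<open>'n\<close>.  Only the values at lists of length \<open>m\<close>
  matter; below such a list is written \<open>i # is\<close> with \<open>length is = m - 1\<close>.
\<close>

type_synonym ('n, 'a) tensor = "'n list \<Rightarrow> 'a"

definition tail_indices :: "nat \<Rightarrow> 'n::finite list set" where
  "tail_indices m = {is. length is = m - 1}"

definition nonneg_tensor :: "nat \<Rightarrow> ('n::finite, real) tensor \<Rightarrow> bool" where
  "nonneg_tensor m A \<longleftrightarrow> (\<forall>i. \<forall>is\<in>tail_indices m. 0 \<le> A (i # is))"

definition tensor_apply ::
    "nat \<Rightarrow> ('n::finite, complex) tensor \<Rightarrow> complex ^ 'n \<Rightarrow> complex ^ 'n" where
  "tensor_apply m A x = (\<chi> i. \<Sum>is\<in>tail_indices m. A (i # is) * (\<Prod>j\<leftarrow>is. x $ j))"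

definition tensor_eigenvalue :: "nat \<Rightarrow> ('n::finite, complex) tensor \<Rightarrow> complex \<Rightarrow> bool" where
  "tensor_eigenvalue m A \<mu> \<longleftrightarrow>
     (\<exists>x. x \<noteq> 0 \<and> tensor_apply m A x = (\<chi> i. \<mu> * (x $ i) ^ (m - 1)))"

text \<open>
  A genuine maximum: the value is unspecified if no eigenvalue attains the largest modulus.
\<close>

definition tensor_spectral_radius :: "nat \<Rightarrow> ('n::finite, complex) tensor \<Rightarrow> real" where
  "tensor_spectral_radius m A = (GREATEST r. \<exists>\<mu>. tensor_eigenvalue m A \<mu> \<and> r = cmod \<mu>)"

definition tensor_digraph ::
    "nat \<Rightarrow> ('n::finite, 'a::zero) tensor \<Rightarrow> ('n, 'n \<times> 'n) pre_digraph" where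
  "tensor_digraph m A =
     \<lparr>verts = UNIV,
      arcs = {(i, j). \<exists>is\<in>tail_indices m. A (i # is) \<noteq> 0 \<and> j \<in> set is},
      tail = fst,
      head = snd\<rparr>"

definition weakly_irreducible :: "nat \<Rightarrow> ('n::finite, 'a::zero) tensor \<Rightarrow> bool" where
  "weakly_irreducible m A \<longleftrightarrow> strongly_connected (tensor_digraph m A)"

text \<open>
  The predicate \<open>pre_digraph.cycle\<close> admits loops, as cycles of length 1.  The girth of a
  digraph without circuits is \<open>\<infinity>\<close>.
\<close>

definition girth :: "('a, 'b) pre_digraph \<Rightarrow> enat" where
  "girth G = (INF p\<in>{p. pre_digraph.cycle G p}. enat (length p))"

definition positive_diagonal_matrices :: "(real ^ 'n::finite ^ 'n) set" where
  "positive_diagonal_matrices = {X. (\<forall>i j. i \<noteq> j \<longrightarrow> X $ i $ j = 0) \<and> (\<forall>i. 0 < X $ i $ i)}"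

text \<open>
  The tensor written \<open>X\<close> to the power \<open>-(m - 1)\<close>, times \<open>A\<close>, times \<open>X\<close>, for an invertible
  diagonal matrix \<open>X\<close>.
\<close>

definition diagonal_scaling ::
    "nat \<Rightarrow> real ^ 'n ^ 'n \<Rightarrow> ('n::finite, real) tensor \<Rightarrow> ('n, real) tensor" where
  "diagonal_scaling m X A =
     (\<lambda>idx. inverse (X $ hd idx $ hd idx ^ (m - 1)) * A idx * (\<Prod>j\<leftarrow>tl idx. X $ j $ j))"

definition slice_sum :: "nat \<Rightarrow> ('n::finite, real) tensor \<Rightarrow> 'n \<Rightarrow> real" where
  "slice_sum m B i = (\<Sum>is\<in>tail_indices m. B (i # is))"

text \<open>
  The \<open>k\<close>-th smallest slice sum counted with multiplicity, for \<open>1 \<le> k \<le> CARD('n)\<close>; the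
  list positions start at 0.
\<close>

definition ordered_slice_sum :: "nat \<Rightarrow> ('n::finite, real) tensor \<Rightarrow> nat \<Rightarrow> real" where
  "ordered_slice_sum m B k =
     sorted_list_of_multiset (image_mset (slice_sum m B) (mset_set UNIV)) ! (k - 1)"

end

theory Submission
  imports Defs
begin

text \<open>
  A positive eigenvector \<open>y\<close> is found by minimising the largest quotient
  \<open>(A z)\<^sub>i / z\<^sub>i ^ (m - 1)\<close> over positive \<open>z\<close>.  Among the minimisers take one with the fewest
  indices attaining the maximum: if not every index attained it, shrinking a coordinate that does
  not attain it, but is an out-neighbour of one that does, would leave fewer.  Comparing any
  eigenvector with \<open>y\<close> shows that the eigenvalue of \<open>y\<close> is \<open>\<rho>\<close>, and scaling by \<open>y\<close> makes all
  slice sums equal to \<open>\<rho>\<close>, which settles attainment.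

  For the inequalities let \<open>w\<^sub>i = x\<^sub>i / y\<^sub>i\<close> and let \<open>f i\<close> be an out-neighbour of \<open>i\<close> with maximal \<open>w\<close>.
  Then \<open>K\<^sub>i \<le> \<rho> (w (f i) / w i) ^ (m - 1)\<close>, and the quotients telescope to 1 along a cycle of \<open>f\<close>,
  which is a circuit and so has at least \<open>g\<close> vertices.  Hence the geometric mean of the \<open>g\<close>
  smallest slice sums is at most \<open>\<rho>\<close>; out-neighbours with minimal \<open>w\<close> give the dual bound.
\<close>

section \<open>The digraph of a tensor\<close>

lemma mem_arcs_tensor_digraph:
  "(i, j) \<in> arcs (tensor_digraph m A) \<longleftrightarrow> (\<exists>is\<in>tail_indices m. A (i # is) \<noteq> 0 \<and> j \<in> set is)"
  by (simp add: tensor_digraph_def)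

lemma weakly_irreducible_rtrancl:
  fixes A :: "('n::finite, 'a::zero) tensor"
  assumes "weakly_irreducible m A"
  shows "(i, j) \<in> (arcs (tensor_digraph m A))\<^sup>*"
proof -
  let ?G = "tensor_digraph m A"
  have ends: "arcs_ends ?G = arcs ?G"
    by (auto simp: arcs_ends_def arc_to_ends_def tensor_digraph_def)
  have "(i, j) \<in> rtrancl_on (verts ?G) (arcs_ends ?G)"
    using assms by (auto simp: weakly_irreducible_def strongly_connected_def reachable_def
        tensor_digraph_def)
  then show ?thesis
    unfolding ends by (induction rule: rtrancl_on.induct) auto
qed

lemma girth_le_cycle_length: "pre_digraph.cycle G p \<Longrightarrow> girth G \<le> enat (length p)"
  unfolding girth_def by (rule INF_lower) simp

text \<open>A nonempty set of \<open>enat\<close> values contains its infimum, and the infimum of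
  the empty set is infinite, so a finite girth is the length of some circuit.\<close>

lemma girth_attained:
  assumes "girth G = enat g"
  obtains p where "pre_digraph.cycle G p" "length p = g"
proof -
  let ?S = "(\<lambda>p. enat (length p)) ` {p. pre_digraph.cycle G p}"
  have ne: "?S \<noteq> {}"
  proof
    assume "?S = {}"
    then have "girth G = Inf {}"
      unfolding girth_def by simp
    then show False
      using assms by (simp add: top_enat_def)
  qed
  then have "Inf ?S \<in> ?S"
    unfolding Inf_enat_def by (metis LeastI_ex ex_in_conv)
  then show ?thesis
    using assms that unfolding girth_def by auto
qed

text \<open>Strong connectivity alone allows a single vertex without a loop. Finite girth supplies
  an arc, and its tail \<open>u\<close> is reachable from \<open>i\<close>: either
  \<open>i = u\<close>, or the path from \<open>i\<close> to \<open>u\<close> starts with an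
  arc.\<close>

lemma weakly_irreducible_out_arc:
  fixes A :: "('n::finite, 'a::zero) tensor"
  assumes irr: "weakly_irreducible m A" and g: "girth (tensor_digraph m A) = enat g"
  shows "\<exists>j. (i, j) \<in> arcs (tensor_digraph m A)"
proof -
  let ?G = "tensor_digraph m A"
  obtain p where "pre_digraph.cycle ?G p"
    using girth_attained[OF g] .
  then have "p \<noteq> []" "set p \<subseteq> arcs ?G"
    by (auto simp: pre_digraph.cycle_def pre_digraph.awalk_def)
  then obtain u v where uv: "(u, v) \<in> arcs ?G"
    by (cases p) auto
  have "(i, u) \<in> (arcs ?G)\<^sup>*"
    by (rule weakly_irreducible_rtrancl[OF irr])
  then show ?thesis
    using uv by (cases rule: converse_rtranclE) auto
qed

lemma girth_tensor_digraph_pos: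
  assumes "girth (tensor_digraph m A) = enat g"
  shows "0 < g"
  using girth_attained[OF assms] by (metis length_greater_0_conv pre_digraph.cycle_def)

text \<open>Iterating a self-map of a finite set leads to a periodic orbit. With the least period
  \<open>p\<close> the orbit is a circuit, so \<open>g \<le> p\<close>, and \<open>f\<close>
  permutes it; the bijection is what later lets products be reindexed.\<close>

lemma cycle_of_selection:
  fixes A :: "('n::finite, 'a::zero) tensor"
  assumes f: "\<And>i. (i, f i) \<in> arcs (tensor_digraph m A)"
    and g: "girth (tensor_digraph m A) = enat g"
  obtains S where "g \<le> card S" "bij_betw f S S"
proof -
  let ?G = "tensor_digraph m A"
  have "\<not> inj (\<lambda>k. (f ^^ k) undefined)"
    using finite_imageD[of "\<lambda>k. (f ^^ k) undefined" UNIV] by auto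
  then obtain a b where ab: "a < b" "(f ^^ a) undefined = (f ^^ b) undefined"
    using linorder_injI[of "\<lambda>k. (f ^^ k) undefined"] by blast
  \<comment> \<open>The starting vertex is arbitrary; the first of two coinciding iterates is a
    periodic point.\<close>
  define x where "x = (f ^^ a) undefined"
  have "(f ^^ (b - a)) x = (f ^^ (b - a + a)) undefined"
    unfolding x_def funpow_add by simp
  then have ex: "\<exists>p. 0 < p \<and> (f ^^ p) x = x"
    using ab by (intro exI[of _ "b - a"]) (simp add: x_def)
  define p where "p = (LEAST p. 0 < p \<and> (f ^^ p) x = x)"
  have p: "0 < p" "(f ^^ p) x = x"
    using LeastI_ex[OF ex] unfolding p_def by auto
  have least: "(f ^^ q) x \<noteq> x" if "0 < q" "q < p" for q
    using not_less_Least[of q] that unfolding p_def by auto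
  \<comment> \<open>The exponents start at 1 because \<open>cycle\<close> asks for distinct vertices
    after the first one is dropped. A coincidence at \<open>c < d\<close> would give the return time
    \<open>p - d + c\<close>, which is smaller than \<open>p\<close>.\<close>
  have inj: "inj_on (\<lambda>k. (f ^^ k) x) {1..p}"
  proof (rule linorder_inj_onI)
    fix c d assume cd: "c < d" "c \<in> {1..p}" "d \<in> {1..p}"
    show "(f ^^ c) x \<noteq> (f ^^ d) x"
    proof
      assume "(f ^^ c) x = (f ^^ d) x"
      then have "(f ^^ (p - d)) ((f ^^ c) x) = (f ^^ (p - d)) ((f ^^ d) x)"
        by simp
      then have "(f ^^ (p - d + c)) x = (f ^^ (p - d + d)) x"
        unfolding funpow_add by simp
      moreover have "0 < p - d + c" "p - d + c < p" "p - d + d = p"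
        using cd unfolding atLeastAtMost_iff by linarith+
      ultimately show False
        using least p by metis
    qed
  qed auto
  define w where "w = map (\<lambda>k. ((f ^^ k) x, (f ^^ Suc k) x))"
  \<comment> \<open>The start exponent \<open>c\<close> stays general, since peeling off the first
    arc shifts it by one.\<close>
  have walk: "pre_digraph.cas ?G ((f ^^ c) x) (w [c..<c + d]) ((f ^^ (c + d)) x) \<and>
      pre_digraph.awalk_verts ?G ((f ^^ c) x) (w [c..<c + d]) = map (\<lambda>k. (f ^^ k) x) [c..<Suc (c + d)]"
    for c d
  proof (induction d arbitrary: c)
    case 0
    then show ?case
      by (simp add: w_def pre_digraph.cas.simps pre_digraph.awalk_verts.simps)
  next
    case (Suc d)
    have "[c..<c + Suc d] = c # [Suc c..<Suc c + d]" "[c..<Suc (c + Suc d)] = c # [Suc c..<Suc (Suc c + d)]"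
      by (simp_all add: upt_rec)
    then show ?case
      using Suc[of "Suc c"]
      by (simp add: w_def pre_digraph.cas.simps pre_digraph.awalk_verts.simps tensor_digraph_def del: upt_Suc)
  qed
  have "pre_digraph.cycle ?G (w [0..<p])"
  proof -
    have "set (w [0..<p]) \<subseteq> arcs ?G"
      using f by (auto simp: w_def)
    moreover have "pre_digraph.cas ?G x (w [0..<p]) x"
      using walk[of 0 p] p by simp
    moreover have "tl (pre_digraph.awalk_verts ?G x (w [0..<p])) = map (\<lambda>k. (f ^^ k) x) [Suc 0..<Suc p]"
      using walk[of 0 p] by (simp add: upt_conv_Cons del: upt_Suc)
    moreover have "distinct (map (\<lambda>k. (f ^^ k) x) [Suc 0..<Suc p])"
      using inj by (simp add: distinct_map atLeastLessThanSuc_atLeastAtMost del: upt_Suc)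
    ultimately show ?thesis
      using p unfolding pre_digraph.cycle_def pre_digraph.awalk_def
      by (intro exI[of _ x]) (auto simp: w_def tensor_digraph_def)
  qed
  then have "g \<le> p"
    using girth_le_cycle_length[of ?G "w [0..<p]"] g by (simp add: w_def)
  define S where "S = (\<lambda>k. (f ^^ k) x) ` {1..p}"
  have card: "card S = p"
    unfolding S_def using inj by (simp add: card_image)
  \<comment> \<open>On a finite set surjectivity gives bijectivity. Only the exponent 1 wraps
    around: \<open>f x\<close> is the image of \<open>(f ^^ p) x = x\<close>.\<close>
  have "S \<subseteq> f ` S"
  proof
    fix y assume "y \<in> S"
    then obtain k where k: "k \<in> {1..p}" "y = (f ^^ k) x"
      by (auto simp: S_def)
    show "y \<in> f ` S"
    proof (cases "k = 1")
      case True
      then have "y = f ((f ^^ p) x)"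
        using k p by simp
      moreover have "(f ^^ p) x \<in> S"
        using p unfolding S_def by (intro imageI) auto
      ultimately show ?thesis
        by blast
    next
      case False
      then obtain l where "k = Suc l" "l \<in> {1..p}"
        using k by (cases k) auto
      then show ?thesis
        using k by (auto simp: S_def)
    qed
  qed
  then have "f ` S = S"
    using card_seteq[of "f ` S" S] by (simp add: card_image_le)
  then have "bij_betw f S S"
    by (simp add: bij_betw_def eq_card_imp_inj_on)
  then show ?thesis
    using that[of S] \<open>g \<le> p\<close> card by simp
qed

section \<open>Monotonicity of the homogeneous form\<close>

text \<open>The real counterpart of \<open>tensor_apply\<close>, taken on functions so that a
  coordinate can be updated or moduli and quotients inserted without conversion to vectors.\<close>

definition tensor_form :: "nat \<Rightarrow> ('n::finite, real) tensor \<Rightarrow> ('n \<Rightarrow> real) \<Rightarrow> 'n \<Rightarrow> real" where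
  "tensor_form m A z i = (\<Sum>is\<in>tail_indices m. A (i # is) * (\<Prod>j\<leftarrow>is. z j))"

lemma finite_tail_indices: "finite (tail_indices m :: 'n::finite list set)"
  using finite_lists_length_eq[of "UNIV :: 'n set"] by (simp add: tail_indices_def)

text \<open>The factor \<open>c\<close> joins monotonicity and homogeneity in one statement;
  nonnegativity is part of the conclusion because the induction multiplies inequalities.\<close>

lemma prod_list_mono_scaled:
  fixes c :: "'b::linordered_semidom"
  assumes "\<And>x. x \<in> set xs \<Longrightarrow> 0 \<le> f x \<and> f x \<le> c * h x"
  shows "0 \<le> (\<Prod>x\<leftarrow>xs. f x) \<and> (\<Prod>x\<leftarrow>xs. f x) \<le> c ^ length xs * (\<Prod>x\<leftarrow>xs. h x)"
  using assms
proof (induction xs)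
  case (Cons a xs)
  then have IH: "0 \<le> (\<Prod>x\<leftarrow>xs. f x)" "(\<Prod>x\<leftarrow>xs. f x) \<le> c ^ length xs * (\<Prod>x\<leftarrow>xs. h x)"
    and a: "0 \<le> f a" "f a \<le> c * h a"
    by auto
  have "f a * (\<Prod>x\<leftarrow>xs. f x) \<le> (c * h a) * (c ^ length xs * (\<Prod>x\<leftarrow>xs. h x))"
    using IH a by (intro mult_mono) auto
  then show ?case
    using IH a by (simp add: mult_ac)
qed simp

text \<open>A monomial with nonzero coefficient involves only out-neighbours of \<open>i\<close>, so
  a comparison on these suffices. With \<open>c = 1\<close> this is monotonicity, with
  \<open>x = c * y\<close> it is one half of homogeneity.\<close>

lemma tensor_form_mono_scaled:
  fixes A :: "('n::finite, real) tensor"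
  assumes A: "nonneg_tensor m A"
    and xy: "\<And>j. (i, j) \<in> arcs (tensor_digraph m A) \<Longrightarrow> 0 \<le> x j \<and> x j \<le> c * y j"
  shows "tensor_form m A x i \<le> c ^ (m - 1) * tensor_form m A y i"
  unfolding tensor_form_def sum_distrib_left
proof (rule sum_mono)
  fix js :: "'n list"
  assume js: "js \<in> tail_indices m"
  show "A (i # js) * (\<Prod>j\<leftarrow>js. x j) \<le> c ^ (m - 1) * (A (i # js) * (\<Prod>j\<leftarrow>js. y j))"
  proof (cases "A (i # js) = 0")
    case False
    then have "(\<Prod>j\<leftarrow>js. x j) \<le> c ^ length js * (\<Prod>j\<leftarrow>js. y j)"
      using prod_list_mono_scaled[of js x c y] xy js mem_arcs_tensor_digraph by blast
    moreover have "length js = m - 1" "0 \<le> A (i # js)"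
      using js A by (auto simp: tail_indices_def nonneg_tensor_def)
    ultimately have "A (i # js) * (\<Prod>j\<leftarrow>js. x j) \<le> A (i # js) * (c ^ (m - 1) * (\<Prod>j\<leftarrow>js. y j))"
      by (intro mult_left_mono) auto
    then show ?thesis
      by (simp add: mult_ac)
  qed simp
qed

lemma tensor_form_nonneg:
  assumes "nonneg_tensor m A" "\<And>j. 0 \<le> z j"
  shows "0 \<le> tensor_form m A z i"
  unfolding tensor_form_def
  using assms by (auto intro!: sum_nonneg mult_nonneg_nonneg prod_list_nonneg simp: nonneg_tensor_def)

lemma tensor_form_term_le:
  fixes A :: "('n::finite, real) tensor"
  assumes "nonneg_tensor m A" "\<And>j. 0 \<le> z j" "is \<in> tail_indices m"
  shows "A (i # is) * (\<Prod>j\<leftarrow>is. z j) \<le> tensor_form m A z i"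
  unfolding tensor_form_def
  using assms by (intro member_le_sum)
    (auto intro!: mult_nonneg_nonneg prod_list_nonneg simp: nonneg_tensor_def finite_tail_indices)

lemma prod_list_pos:
  fixes f :: "'a \<Rightarrow> 'b::linordered_semidom"
  shows "(\<And>x. x \<in> set xs \<Longrightarrow> 0 < f x) \<Longrightarrow> 0 < (\<Prod>x\<leftarrow>xs. f x)"
  by (induction xs) auto

lemma tensor_form_pos:
  fixes A :: "('n::finite, real) tensor"
  assumes A: "nonneg_tensor m A" and z: "\<And>j. 0 < z j"
    and arc: "(i, j) \<in> arcs (tensor_digraph m A)"
  shows "0 < tensor_form m A z i"
proof -
  obtain js where js: "js \<in> tail_indices m" "A (i # js) \<noteq> 0"
    using arc mem_arcs_tensor_digraph by blast
  have "0 \<le> A (i # js)"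
    using A js by (simp add: nonneg_tensor_def)
  then have "0 < A (i # js) * (\<Prod>j\<leftarrow>js. z j)"
    using js z prod_list_pos[of js z] by simp
  also have "\<dots> \<le> tensor_form m A z i"
    using A js z less_imp_le by (intro tensor_form_term_le) auto
  finally show ?thesis .
qed

lemma prod_list_strict_mono:
  fixes f h :: "'a \<Rightarrow> 'b::linordered_semidom"
  assumes "\<And>x. x \<in> set xs \<Longrightarrow> 0 < f x \<and> f x \<le> h x" "y \<in> set xs" "f y < h y"
  shows "(\<Prod>x\<leftarrow>xs. f x) < (\<Prod>x\<leftarrow>xs. h x)"
  using assms
proof (induction xs)
  case (Cons a xs)
  have le: "(\<Prod>x\<leftarrow>xs. f x) \<le> (\<Prod>x\<leftarrow>xs. h x)"
    using prod_list_mono_scaled[of xs f 1 h] Cons.prems(1) by (simp add: less_imp_le)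
  have pos: "0 < (\<Prod>x\<leftarrow>xs. f x)" "0 < f a" "f a \<le> h a"
    using Cons.prems(1) by (auto intro: prod_list_pos)
  show ?case
  proof (cases "y = a")
    case True
    then have "f a * (\<Prod>x\<leftarrow>xs. f x) < h a * (\<Prod>x\<leftarrow>xs. h x)"
      using Cons.prems(3) le pos by (intro mult_less_le_imp_less) auto
    then show ?thesis
      by simp
  next
    case False
    then have "(\<Prod>x\<leftarrow>xs. f x) < (\<Prod>x\<leftarrow>xs. h x)"
      using Cons by auto
    then have "f a * (\<Prod>x\<leftarrow>xs. f x) < h a * (\<Prod>x\<leftarrow>xs. h x)"
      using pos by (intro mult_le_less_imp_less) auto
    then show ?thesis
      by simp
  qed
qed simp

text \<open>The arc supplies a monomial with positive coefficient that contains the variable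
  \<open>j\<close>; its other factors are positive, so the strict inequality survives.\<close>

lemma tensor_form_strict_mono:
  fixes A :: "('n::finite, real) tensor"
  assumes A: "nonneg_tensor m A" and xy: "\<And>k. 0 < x k \<and> x k \<le> y k"
    and arc: "(i, j) \<in> arcs (tensor_digraph m A)" and less: "x j < y j"
  shows "tensor_form m A x i < tensor_form m A y i"
  unfolding tensor_form_def
proof (rule sum_strict_mono_ex1)
  show "finite (tail_indices m :: 'n list set)"
    by (rule finite_tail_indices)
  show "\<forall>js\<in>tail_indices m. A (i # js) * (\<Prod>j\<leftarrow>js. x j) \<le> A (i # js) * (\<Prod>j\<leftarrow>js. y j)"
  proof
    fix js :: "'n list"
    assume "js \<in> tail_indices m"
    moreover have "(\<Prod>j\<leftarrow>js. x j) \<le> (\<Prod>j\<leftarrow>js. y j)"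
      using prod_list_mono_scaled[of js x 1 y] xy by (simp add: less_imp_le)
    ultimately show "A (i # js) * (\<Prod>j\<leftarrow>js. x j) \<le> A (i # js) * (\<Prod>j\<leftarrow>js. y j)"
      using A by (auto intro: mult_left_mono simp: nonneg_tensor_def)
  qed
  obtain js where js: "js \<in> tail_indices m" "A (i # js) \<noteq> 0" "j \<in> set js"
    using arc mem_arcs_tensor_digraph by blast
  then have "0 < A (i # js)"
    using A by (simp add: nonneg_tensor_def order_less_le)
  then show "\<exists>js\<in>tail_indices m. A (i # js) * (\<Prod>j\<leftarrow>js. x j) < A (i # js) * (\<Prod>j\<leftarrow>js. y j)"
    using js prod_list_strict_mono[of js x y j] xy less by (intro bexI[of _ js]) auto
qed

section \<open>The positive eigenvector\<close>

lemma le_prod_list_member: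
  fixes f :: "'a \<Rightarrow> 'b::linordered_semidom"
  assumes "\<And>x. x \<in> set xs \<Longrightarrow> 1 \<le> f x" "y \<in> set xs"
  shows "f y \<le> (\<Prod>x\<leftarrow>xs. f x)"
  using assms
proof (induction xs)
  case (Cons a xs)
  have ge1: "1 \<le> (\<Prod>x\<leftarrow>xs. f x)" "1 \<le> f a"
    using Cons.prems(1) prod_list_mono_scaled[of xs "\<lambda>_. 1" 1 f] by (auto simp: map_replicate_const)
  show ?case
  proof (cases "y = a")
    case True
    then show ?thesis
      using ge1 mult_left_mono[of 1 "\<Prod>x\<leftarrow>xs. f x" "f a"] by (simp add: order_trans[OF zero_le_one])
  next
    case False
    then have "f y \<le> (\<Prod>x\<leftarrow>xs. f x)"
      using Cons by auto
    also have "\<dots> \<le> f a * (\<Prod>x\<leftarrow>xs. f x)"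
      using ge1 mult_right_mono[of 1 "f a" "\<Prod>x\<leftarrow>xs. f x"] by (simp add: order_trans[OF zero_le_one])
    finally show ?thesis
      by simp
  qed
qed simp

text \<open>
  The normalisation \<open>1 \<le> z k\<close> is essential: it lets the factors other than \<open>z j\<close> in a monomial
  be dropped, so that a bound on one coordinate passes along arcs.
\<close>

lemma reachable_coordinate_bound:
  fixes A :: "('n::finite, real) tensor"
  assumes A: "nonneg_tensor m A" and "(i, j) \<in> (arcs (tensor_digraph m A))\<^sup>*"
  shows "\<exists>R. \<forall>z. (\<forall>k. 1 \<le> z k) \<longrightarrow> (\<forall>k. tensor_form m A z k \<le> M * z k ^ (m - 1)) \<longrightarrow>
    z i \<le> c \<longrightarrow> z j \<le> R"
  using assms(2)
proof (induction rule: rtrancl_induct)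
  case (step j k)
  from step.IH obtain R where R: "\<And>z. (\<And>k. 1 \<le> z k) \<Longrightarrow>
      (\<And>k. tensor_form m A z k \<le> M * z k ^ (m - 1)) \<Longrightarrow> z i \<le> c \<Longrightarrow> z j \<le> R"
    by blast
  obtain js where js: "js \<in> tail_indices m" "A (j # js) \<noteq> 0" "k \<in> set js"
    using step.hyps mem_arcs_tensor_digraph by blast
  then have pos: "0 < A (j # js)"
    using A by (simp add: nonneg_tensor_def order_less_le)
  \<comment> \<open>One monomial of slice \<open>j\<close> contains \<open>z k\<close> and is
    bounded by the whole form, hence by \<open>M * z j ^ (m - 1)\<close>. The absolute value spares
    a case distinction on the sign of \<open>M\<close>.\<close>
  have "z k \<le> \<bar>M\<bar> * R ^ (m - 1) / A (j # js)"
    if z: "\<And>k. 1 \<le> z k" and le: "\<And>k. tensor_form m A z k \<le> M * z k ^ (m - 1)" and "z i \<le> c" for z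
  proof -
    have nonneg: "0 \<le> z l" for l
      using z[of l] by simp
    have "A (j # js) * z k \<le> A (j # js) * (\<Prod>l\<leftarrow>js. z l)"
      using le_prod_list_member[of js z k] z js pos by simp
    also have "\<dots> \<le> M * z j ^ (m - 1)"
      using tensor_form_term_le[OF A, of z js j] nonneg js le[of j] by simp
    also have "\<dots> \<le> \<bar>M\<bar> * R ^ (m - 1)"
      using R[of z] that nonneg by (intro mult_mono power_mono) auto
    finally show ?thesis
      using pos by (simp add: field_simps)
  qed
  then show ?case
    by blast
qed auto

section \<open>Minimisation of the largest Collatz-Wielandt quotient\<close>

lemma continuous_on_prod_list:
  fixes f :: "'a \<Rightarrow> 'b::topological_space \<Rightarrow> 'c::{monoid_mult, topological_semigroup_mult}"
  assumes "\<And>x. x \<in> set xs \<Longrightarrow> continuous_on S (f x)"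
  shows "continuous_on S (\<lambda>t. \<Prod>x\<leftarrow>xs. f x t)"
  using assms
proof (induction xs)
  case (Cons a xs)
  then have "continuous_on S (\<lambda>t. f a t * (\<Prod>x\<leftarrow>xs. f x t))"
    by (intro continuous_on_mult') simp_all
  then show ?case
    by simp
qed simp

lemma continuous_on_Max_image:
  fixes f :: "'a \<Rightarrow> 'b::topological_space \<Rightarrow> 'c::linorder_topology"
  assumes "finite I" "I \<noteq> {}" "\<And>i. i \<in> I \<Longrightarrow> continuous_on S (f i)"
  shows "continuous_on S (\<lambda>t. Max ((\<lambda>i. f i t) ` I))"
  using assms
proof (induction I rule: finite_ne_induct)
  case (insert a I)
  then have "continuous_on S (\<lambda>t. max (f a t) (Max ((\<lambda>i. f i t) ` I)))"
    by (intro continuous_on_max) simp_all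
  then show ?case
    using insert.hyps by simp
qed simp

text \<open>The positive cone is not compact. Up to scaling, though, a vector doing at least as well
  as the all-ones vector has smallest coordinate 1 and all coordinates below a common bound, so a
  compact box suffices. The last conclusion says that no positive vector has all its quotients below
  \<open>r\<close>.\<close>

lemma collatz_wielandt_attained:
  fixes A :: "('n::finite, real) tensor"
  assumes A: "nonneg_tensor m A" and irr: "weakly_irreducible m A"
  obtains z r where "\<And>i. 0 < z i" "\<And>i. tensor_form m A z i \<le> r * z i ^ (m - 1)"
    "\<And>x. (\<And>i. 0 < x i) \<Longrightarrow> \<exists>i. r * x i ^ (m - 1) \<le> tensor_form m A x i"
proof -
  define F :: "real ^ 'n \<Rightarrow> real" where
    "F v = Max (range (\<lambda>i. tensor_form m A (vec_nth v) i / v $ i ^ (m - 1)))" for v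
  define M where "M = F (\<chi> i. 1)"
  have "\<exists>R. \<forall>z. (\<forall>k. 1 \<le> z k) \<longrightarrow> (\<forall>k. tensor_form m A z k \<le> M * z k ^ (m - 1)) \<longrightarrow>
    z i \<le> 1 \<longrightarrow> z j \<le> R" for i j
    using reachable_coordinate_bound[OF A weakly_irreducible_rtrancl[OF irr]] by blast
  then obtain R where R: "\<And>i j z. (\<And>k. 1 \<le> z k) \<Longrightarrow>
      (\<And>k. tensor_form m A z k \<le> M * z k ^ (m - 1)) \<Longrightarrow> z i \<le> 1 \<Longrightarrow> z j \<le> R i j"
    by metis
  \<comment> \<open>\<open>R i j\<close> bounds coordinate \<open>j\<close> when the smallest
    coordinate sits at \<open>i\<close>; the inserted 1 keeps the all-ones vector in the
    box.\<close>
  define R' where "R' = Max (insert 1 (range (\<lambda>(i, j). R i j)))"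
  have R'1: "1 \<le> R'"
    unfolding R'_def by (intro Max_ge) auto
  have R'ge: "R i j \<le> R'" for i j
    unfolding R'_def by (intro Max_ge) auto
  define C :: "(real ^ 'n) set" where "C = cbox (\<chi> i. 1) (\<chi> i. R')"
  have memC: "v \<in> C \<longleftrightarrow> (\<forall>i. 1 \<le> v $ i \<and> v $ i \<le> R')" for v
    by (simp add: C_def mem_box_cart)
  have one: "(\<chi> i. 1) \<in> C"
    using R'1 by (simp add: memC)
  have C_pos: "0 < u $ i" if "u \<in> C" for u i
    using that by (auto simp: memC intro: less_le_trans[OF zero_less_one])
  then have C_ne: "u $ i \<noteq> 0" if "u \<in> C" for u i
    using that by (metis less_irrefl)
  have "continuous_on C F"
    unfolding F_def tensor_form_def
    by (intro continuous_on_Max_image continuous_intros continuous_on_prod_list) (auto simp: C_ne)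
  then obtain v where v: "v \<in> C" "\<And>u. u \<in> C \<Longrightarrow> F v \<le> F u"
    using continuous_attains_inf[of C F] one by (auto simp: C_def)
  have vpos: "0 < v $ i" for i
    using C_pos v(1) .
  have le_F: "tensor_form m A (vec_nth u) i / u $ i ^ (m - 1) \<le> F u" for u i
    unfolding F_def by (rule Max_ge) auto
  have "\<exists>i. F v * x i ^ (m - 1) \<le> tensor_form m A x i" if x: "\<And>i. 0 < x i" for x
  proof (rule ccontr)
    assume "\<not> ?thesis"
    then have less: "\<And>i. tensor_form m A x i < F v * x i ^ (m - 1)"
      by (auto simp: not_le)
    define d where "d = Min (range x)"
    have "d \<in> range x"
      unfolding d_def by (intro Min_in) auto
    then obtain k where k: "d = x k"
      by auto
    have d: "0 < d" "\<And>i. d \<le> x i"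
      unfolding d_def using x by auto
    \<comment> \<open>By homogeneity the quotients of \<open>u\<close> are those of
      \<open>x\<close>, hence all below \<open>F v\<close>. Its smallest coordinate is 1, at
      \<open>k\<close>, so the bounds \<open>R k j\<close> put \<open>u\<close> into the box,
      against the minimality of \<open>v\<close>.\<close>
    define u :: "real ^ 'n" where "u = (\<chi> i. x i / d)"
    have u1: "1 \<le> u $ i" for i
      using d by (simp add: u_def)
    have "tensor_form m A (vec_nth u) i \<le> (1 / d) ^ (m - 1) * tensor_form m A x i" for i
      using d x by (intro tensor_form_mono_scaled[OF A]) (auto simp: u_def less_imp_le)
    also have "(1 / d) ^ (m - 1) * tensor_form m A x i < (1 / d) ^ (m - 1) * (F v * x i ^ (m - 1))" for i
      using less[of i] d by (intro mult_strict_left_mono) auto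
    finally have less_u: "tensor_form m A (vec_nth u) i < F v * u $ i ^ (m - 1)" for i
      by (simp add: u_def power_divide mult_ac)
    have "F v \<le> M"
      using v one by (simp add: M_def)
    then have "tensor_form m A (vec_nth u) i \<le> M * u $ i ^ (m - 1)" for i
      using less_u[of i] u1[of i] by (meson less_imp_le mult_right_mono order_trans zero_le_one zero_le_power)
    moreover have "u $ k \<le> 1"
      using d by (simp add: u_def k)
    ultimately have "u $ j \<le> R k j" for j
      using R[of "vec_nth u"] u1 by blast
    then have "u \<in> C"
      using u1 R'ge order_trans by (fastforce simp: memC)
    moreover have "F u < F v"
      unfolding F_def[of u]
    proof (subst Max_less_iff)
      have "tensor_form m A (vec_nth u) i / u $ i ^ (m - 1) < F v" for i
        using less_u[of i] u1[of i] by (simp add: pos_divide_less_eq less_le_trans[OF zero_less_one])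
      then show "\<forall>a\<in>range (\<lambda>i. tensor_form m A (vec_nth u) i / u $ i ^ (m - 1)). a < F v"
        by auto
    qed auto
    ultimately show False
      using v by (simp add: not_le[symmetric])
  qed
  moreover have "tensor_form m A (vec_nth v) i \<le> F v * v $ i ^ (m - 1)" for i
    using le_F[of v i] vpos[of i] by (simp add: pos_divide_le_eq)
  ultimately show ?thesis
    using vpos that[of "vec_nth v" "F v"] by blast
qed

text \<open>Left continuity of the power at \<open>a\<close>; it gives the room for shrinking a
  coordinate whose inequality is strict.\<close>

lemma power_less_near:
  fixes a :: real
  assumes "0 < a" "b < r * a ^ k"
  obtains t where "0 < t" "t < a" "b < r * t ^ k"
proof -
  have "((\<lambda>t. r * t ^ k) \<longlongrightarrow> r * a ^ k) (at_left a)"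
    by (intro tendsto_intros)
  then have "eventually (\<lambda>t. b < r * t ^ k) (at_left a)"
    using assms(2) by (rule order_tendstoD)
  moreover have "eventually (\<lambda>t. t \<in> {0<..<a}) (at_left a)"
    using assms(1) by (rule eventually_at_left_real)
  ultimately have "eventually (\<lambda>t. b < r * t ^ k \<and> t \<in> {0<..<a}) (at_left a)"
    by (rule eventually_conj)
  then have "\<exists>t. b < r * t ^ k \<and> t \<in> {0<..<a}"
    by (rule eventually_happens'[OF trivial_limit_at_left_real])
  then show ?thesis
    using that by auto
qed

lemma positive_eigenvector:
  fixes A :: "('n::finite, real) tensor"
  assumes A: "nonneg_tensor m A" and irr: "weakly_irreducible m A"
  obtains y r where "\<And>i. 0 < y i" "\<And>i. tensor_form m A y i = r * y i ^ (m - 1)"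
proof -
  obtain z0 r where z0: "\<And>i. 0 < z0 i" "\<And>i. tensor_form m A z0 i \<le> r * z0 i ^ (m - 1)"
    and min: "\<And>x. (\<And>i. 0 < x i) \<Longrightarrow> \<exists>i. r * x i ^ (m - 1) \<le> tensor_form m A x i"
    using collatz_wielandt_attained[OF A irr] by blast
  define P where "P z \<longleftrightarrow> (\<forall>i. 0 < z i) \<and> (\<forall>i. tensor_form m A z i \<le> r * z i ^ (m - 1))" for z
  \<comment> \<open>The indices whose inequality is tight; the aim is a \<open>z\<close> for which
    all are.\<close>
  define T where "T z = {i. tensor_form m A z i = r * z i ^ (m - 1)}" for z
  have "P z0"
    using z0 by (simp add: P_def)
  then obtain z where z: "P z" and least: "\<And>x. P x \<Longrightarrow> card (T z) \<le> card (T x)"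
    using ex_has_least_nat[of P z0 "\<lambda>z. card (T z)"] by blast
  have zpos: "\<And>i. 0 < z i" and zle: "\<And>i. tensor_form m A z i \<le> r * z i ^ (m - 1)"
    using z by (auto simp: P_def)
  have "T z = UNIV"
  proof (rule ccontr)
    assume "T z \<noteq> UNIV"
    then obtain b where b: "b \<notin> T z"
      by auto
    obtain a where "r * z a ^ (m - 1) \<le> tensor_form m A z a"
      using min[of z] zpos by blast
    then have a: "a \<in> T z"
      using zle[of a] by (simp add: T_def)
    have "(a, b) \<in> (arcs (tensor_digraph m A))\<^sup>*"
      by (rule weakly_irreducible_rtrancl[OF irr])
    \<comment> \<open>A path from a tight index to one that is not tight must leave
      \<open>T z\<close> along some arc.\<close>
    then have "\<exists>i j. (i, j) \<in> arcs (tensor_digraph m A) \<and> i \<in> T z \<and> j \<notin> T z"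
      using a b by (induction rule: rtrancl_induct) auto
    then obtain i j where ij: "(i, j) \<in> arcs (tensor_digraph m A)" "i \<in> T z" "j \<notin> T z"
      by blast
    have "tensor_form m A z j < r * z j ^ (m - 1)"
      using zle[of j] ij by (simp add: T_def)
    then obtain t where t: "0 < t" "t < z j" "tensor_form m A z j < r * t ^ (m - 1)"
      using power_less_near zpos by metis
    \<comment> \<open>Shrinking coordinate \<open>j\<close> lowers no right-hand side but its own,
      where the choice of \<open>t\<close> keeps the inequality strict. No form increases, so no
      index becomes tight, and the form at \<open>i\<close> drops strictly, so \<open>i\<close>
      stops being tight.\<close>
    define x where "x = z(j := t)"
    have x: "0 < x k \<and> x k \<le> z k" for k
      using t zpos by (auto simp: x_def)
    have le: "tensor_form m A x k \<le> tensor_form m A z k" for k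
      using tensor_form_mono_scaled[OF A, of k x 1 z] x by (simp add: less_imp_le)
    have "tensor_form m A x k \<le> r * x k ^ (m - 1)" for k
      using le[of k] t zle[of k] by (cases "k = j") (auto simp: x_def)
    then have "P x"
      using x by (auto simp: P_def)
    moreover have "T x \<subset> T z"
    proof -
      have "k \<in> T z" if "k \<in> T x" for k
        using that le[of k] t zle[of k] by (cases "k = j") (auto simp: x_def T_def)
      moreover have "tensor_form m A x i < tensor_form m A z i"
        using x ij t by (intro tensor_form_strict_mono[OF A]) (auto simp: x_def)
      then have "i \<notin> T x"
        using ij zle[of i] by (auto simp: T_def x_def)
      ultimately show ?thesis
        using ij by auto
    qed
    ultimately show False
      using least[of x] psubset_card_mono[of "T z" "T x"] by simp
  qed
  then show ?thesis
    using that[of z r] zpos by (auto simp: T_def)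
qed

text \<open>For any complex eigenvector \<open>x\<close>, the least multiple \<open>c * y\<close>
  dominating the moduli of \<open>x\<close> touches them at some coordinate \<open>i\<close>. The
  triangle inequality and monotonicity at \<open>i\<close> then bound the modulus of the eigenvalue
  by \<open>r\<close>.\<close>

lemma spectral_radius_eq_positive_eigenvalue:
  fixes A :: "('n::finite, real) tensor"
  assumes A: "nonneg_tensor m A" and y: "\<And>i. 0 < y i"
    and eig: "\<And>i. tensor_form m A y i = r * y i ^ (m - 1)"
  shows "tensor_spectral_radius m (\<lambda>idx. complex_of_real (A idx)) = r"
  unfolding tensor_spectral_radius_def
proof (rule Greatest_equality)
  let ?A = "\<lambda>idx. complex_of_real (A idx)"
  have of_real_prod_list: "complex_of_real (\<Prod>j\<leftarrow>js. y j) = (\<Prod>j\<leftarrow>js. complex_of_real (y j))" for js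
    by (induction js) auto
  have "0 \<le> r * y undefined ^ (m - 1)"
    using tensor_form_nonneg[OF A, of y] y eig by (metis less_imp_le)
  moreover have "0 < y undefined ^ (m - 1)"
    using y by simp
  ultimately have "0 \<le> r"
    by (meson mult_neg_pos not_le)
  have "tensor_apply m ?A (\<chi> i. complex_of_real (y i)) $ i = complex_of_real (tensor_form m A y i)" for i
    by (simp add: tensor_apply_def tensor_form_def of_real_prod_list)
  moreover have "(\<chi> i. complex_of_real (y i)) \<noteq> 0"
    using y[of undefined] by (auto simp: vec_eq_iff intro!: exI[of _ undefined])
  ultimately have "tensor_eigenvalue m ?A (complex_of_real r)"
    unfolding tensor_eigenvalue_def
    by (intro exI[of _ "\<chi> i. complex_of_real (y i)"]) (simp add: vec_eq_iff eig)
  then show "\<exists>\<mu>. tensor_eigenvalue m ?A \<mu> \<and> r = cmod \<mu>"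
    using \<open>0 \<le> r\<close> by (intro exI[of _ "complex_of_real r"]) simp
next
  let ?A = "\<lambda>idx. complex_of_real (A idx)"
  fix s
  assume "\<exists>\<mu>. tensor_eigenvalue m ?A \<mu> \<and> s = cmod \<mu>"
  then obtain \<mu> x where s: "s = cmod \<mu>" and "x \<noteq> 0"
    and x: "tensor_apply m ?A x = (\<chi> i. \<mu> * (x $ i) ^ (m - 1))"
    unfolding tensor_eigenvalue_def by blast
  define c where "c = Max (range (\<lambda>i. cmod (x $ i) / y i))"
  have "c \<in> range (\<lambda>i. cmod (x $ i) / y i)"
    unfolding c_def by (intro Max_in) auto
  then obtain i where i: "c = cmod (x $ i) / y i"
    by auto
  have c_ge: "cmod (x $ j) / y j \<le> c" for j
    unfolding c_def by (intro Max_ge) auto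
  have le: "cmod (x $ j) \<le> c * y j" for j
    using c_ge[of j] y[of j] by (simp add: pos_divide_le_eq)
  obtain j where "x $ j \<noteq> 0"
    using \<open>x \<noteq> 0\<close> by (auto simp: vec_eq_iff)
  then have "0 < c"
    using c_ge[of j] y[of j] by (meson divide_pos_pos less_le_trans zero_less_norm_iff)
  have norm_prod_list: "cmod (\<Prod>j\<leftarrow>js. x $ j) = (\<Prod>j\<leftarrow>js. cmod (x $ j))" for js
    by (induction js) (auto simp: norm_mult)
  have "\<mu> * (x $ i) ^ (m - 1) = tensor_apply m ?A x $ i"
    by (simp add: x)
  then have "s * cmod (x $ i) ^ (m - 1) = cmod (tensor_apply m ?A x $ i)"
    by (metis norm_mult norm_power s)
  also have "\<dots> \<le> (\<Sum>js\<in>tail_indices m. cmod (?A (i # js) * (\<Prod>j\<leftarrow>js. x $ j)))"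
    unfolding tensor_apply_def by (simp add: norm_sum)
  also have "\<dots> = tensor_form m A (\<lambda>j. cmod (x $ j)) i"
    unfolding tensor_form_def using A
    by (intro sum.cong) (auto simp: norm_mult norm_prod_list nonneg_tensor_def)
  also have "\<dots> \<le> c ^ (m - 1) * tensor_form m A y i"
    using le by (intro tensor_form_mono_scaled[OF A]) auto
  also have "\<dots> = r * (c * y i) ^ (m - 1)"
    by (simp add: eig power_mult_distrib)
  also have "c * y i = cmod (x $ i)"
    using i y[of i] by simp
  finally have "s * cmod (x $ i) ^ (m - 1) \<le> r * cmod (x $ i) ^ (m - 1)" .
  moreover have "0 < cmod (x $ i)"
    using i \<open>0 < c\<close> y[of i] by (simp add: zero_less_divide_iff)
  ultimately show "s \<le> r"
    by simp
qed

section \<open>Slice sums along a cycle\<close>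

lemma slice_sum_diagonal_scaling:
  "slice_sum m (diagonal_scaling m X A) i
    = tensor_form m A (\<lambda>j. X $ j $ j) i / (X $ i $ i) ^ (m - 1)"
  unfolding slice_sum_def diagonal_scaling_def tensor_form_def
  by (simp add: sum_distrib_left divide_inverse mult_ac)

text \<open>Since \<open>f\<close> permutes \<open>S\<close>, the numerators and the denominators of
  the quotients have the same product.\<close>

lemma slice_prod_along_cycle:
  fixes x y :: "'n \<Rightarrow> real"
  assumes "bij_betw f S S" "\<And>i. 0 < x i" "\<And>i. 0 < y i"
  shows "(\<Prod>i\<in>S. r * ((x (f i) / y (f i)) / (x i / y i)) ^ k) = r ^ card S"
proof -
  have "(\<Prod>i\<in>S. x (f i) / y (f i)) = (\<Prod>i\<in>S. x i / y i)"
    using prod.reindex_bij_betw[OF assms(1)] .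
  moreover have "(\<Prod>i\<in>S. x i / y i) \<noteq> 0"
    using assms(2,3) by (cases "finite S") (auto simp: less_imp_neq[symmetric])
  ultimately have "(\<Prod>i\<in>S. (x (f i) / y (f i)) / (x i / y i)) = 1"
    unfolding prod_dividef[of "\<lambda>i. x (f i) / y (f i)"] by simp
  then show ?thesis
    by (simp add: prod.distrib flip: prod_power_distrib)
qed

lemma cycle_slice_prod_le:
  fixes A :: "('n::finite, real) tensor"
  assumes A: "nonneg_tensor m A" and irr: "weakly_irreducible m A"
    and g: "girth (tensor_digraph m A) = enat g"
    and y: "\<And>i. 0 < y i" and eig: "\<And>i. tensor_form m A y i = r * y i ^ (m - 1)"
    and x: "\<And>i. 0 < x i"
  obtains S where "g \<le> card S" "(\<Prod>i\<in>S. tensor_form m A x i / x i ^ (m - 1)) \<le> r ^ card S"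
proof -
  let ?E = "arcs (tensor_digraph m A)"
  have "\<exists>j. (i, j) \<in> ?E \<and> (\<forall>k. (i, k) \<in> ?E \<longrightarrow> x k / y k \<le> x j / y j)" for i
  proof -
    let ?N = "{j. (i, j) \<in> ?E}" and ?w = "\<lambda>j. x j / y j"
    have "?N \<noteq> {}"
      using weakly_irreducible_out_arc[OF irr g] by auto
    then have "Max (?w ` ?N) \<in> ?w ` ?N"
      by (intro Max_in) auto
    then obtain j where j: "j \<in> ?N" "Max (?w ` ?N) = ?w j"
      by blast
    have "?w k \<le> ?w j" if "(i, k) \<in> ?E" for k
      unfolding j(2)[symmetric] using that by (intro Max_ge) auto
    then show ?thesis
      using j(1) by blast
  qed
  then obtain f where f: "\<And>i. (i, f i) \<in> ?E" "\<And>i k. (i, k) \<in> ?E \<Longrightarrow> x k / y k \<le> x (f i) / y (f i)"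
    by metis
  obtain S where S: "g \<le> card S" "bij_betw f S S"
    using cycle_of_selection[OF f(1) g] .
  have "tensor_form m A x i / x i ^ (m - 1) \<le> r * ((x (f i) / y (f i)) / (x i / y i)) ^ (m - 1)" for i
  proof -
    \<comment> \<open>Maximality of \<open>f i\<close> makes \<open>x\<close> at most this multiple
      of \<open>y\<close> on the out-neighbours of \<open>i\<close>, all that the scaled
      monotonicity asks for.\<close>
    have "x k \<le> x (f i) / y (f i) * y k" if "(i, k) \<in> ?E" for k
      using f(2)[OF that] y[of k] by (simp add: pos_divide_le_eq)
    then have "tensor_form m A x i \<le> (x (f i) / y (f i)) ^ (m - 1) * (r * y i ^ (m - 1))"
      using tensor_form_mono_scaled[OF A, of i x _ y] x by (simp add: less_imp_le eig)
    then show ?thesis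
      using x[of i] y[of i] x[of "f i"] y[of "f i"] by (simp add: field_simps)
  qed
  then have "(\<Prod>i\<in>S. tensor_form m A x i / x i ^ (m - 1))
      \<le> (\<Prod>i\<in>S. r * ((x (f i) / y (f i)) / (x i / y i)) ^ (m - 1))"
    using x tensor_form_nonneg[OF A, of x] by (intro prod_mono) (auto simp: less_imp_le)
  then show ?thesis
    using that[of S] S slice_prod_along_cycle[of f S x y] x y by simp
qed

lemma cycle_slice_prod_ge:
  fixes A :: "('n::finite, real) tensor"
  assumes A: "nonneg_tensor m A" and irr: "weakly_irreducible m A"
    and g: "girth (tensor_digraph m A) = enat g"
    and y: "\<And>i. 0 < y i" and eig: "\<And>i. tensor_form m A y i = r * y i ^ (m - 1)"
    and x: "\<And>i. 0 < x i" and r: "0 \<le> r"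
  obtains S where "g \<le> card S" "r ^ card S \<le> (\<Prod>i\<in>S. tensor_form m A x i / x i ^ (m - 1))"
proof -
  let ?E = "arcs (tensor_digraph m A)"
  have "\<exists>j. (i, j) \<in> ?E \<and> (\<forall>k. (i, k) \<in> ?E \<longrightarrow> x j / y j \<le> x k / y k)" for i
  proof -
    let ?N = "{j. (i, j) \<in> ?E}" and ?w = "\<lambda>j. x j / y j"
    have "?N \<noteq> {}"
      using weakly_irreducible_out_arc[OF irr g] by auto
    then have "Min (?w ` ?N) \<in> ?w ` ?N"
      by (intro Min_in) auto
    then obtain j where j: "j \<in> ?N" "Min (?w ` ?N) = ?w j"
      by blast
    have "?w j \<le> ?w k" if "(i, k) \<in> ?E" for k
      unfolding j(2)[symmetric] using that by (intro Min_le) auto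
    then show ?thesis
      using j(1) by blast
  qed
  then obtain f where f: "\<And>i. (i, f i) \<in> ?E" "\<And>i k. (i, k) \<in> ?E \<Longrightarrow> x (f i) / y (f i) \<le> x k / y k"
    by metis
  obtain S where S: "g \<le> card S" "bij_betw f S S"
    using cycle_of_selection[OF f(1) g] .
  have "r * ((x (f i) / y (f i)) / (x i / y i)) ^ (m - 1) \<le> tensor_form m A x i / x i ^ (m - 1)" for i
  proof -
    \<comment> \<open>The roles of \<open>x\<close> and \<open>y\<close> are exchanged: minimality
      of \<open>f i\<close> bounds \<open>y\<close> by a multiple of \<open>x\<close> on the
      out-neighbours.\<close>
    have "y k \<le> y (f i) / x (f i) * x k" if "(i, k) \<in> ?E" for k
      using f(2)[OF that] x y by (simp add: field_simps)
    then have "r * y i ^ (m - 1) \<le> (y (f i) / x (f i)) ^ (m - 1) * tensor_form m A x i"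
      using tensor_form_mono_scaled[OF A, of i y _ x] y by (simp add: less_imp_le eig)
    then show ?thesis
      using x[of i] y[of i] x[of "f i"] y[of "f i"] by (simp add: field_simps)
  qed
  then have "(\<Prod>i\<in>S. r * ((x (f i) / y (f i)) / (x i / y i)) ^ (m - 1))
      \<le> (\<Prod>i\<in>S. tensor_form m A x i / x i ^ (m - 1))"
    using x y r by (intro prod_mono) (auto simp: less_imp_le)
  then show ?thesis
    using that[of S] S slice_prod_along_cycle[of f S x y] x y by simp
qed

section \<open>Products of extreme order statistics\<close>

text \<open>The k-th smallest element of \<open>J\<close> is at least \<open>k\<close>. The
  induction removes the maximum \<open>b\<close>, which is at least the cardinality because the
  whole set lies in \<open>{1..b}\<close>.\<close>

lemma prod_initial_segment_le:
  fixes l :: "nat \<Rightarrow> real"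
  assumes "finite J" "J \<subseteq> {1..n}" "mono_on {1..n} l" "\<And>i. i \<in> {1..n} \<Longrightarrow> 0 < l i"
  shows "(\<Prod>i=1..card J. l i) \<le> (\<Prod>i\<in>J. l i)"
  using assms(1,2)
proof (induction J rule: finite_linorder_max_induct)
  case (insert b J)
  have card: "card (insert b J) = Suc (card J)"
    using insert by (subst card_insert_disjoint) auto
  have "insert b J \<subseteq> {1..b}"
    using insert by force
  then have "card (insert b J) \<le> b"
    using card_mono[of "{1..b}"] by fastforce
  then have b: "Suc (card J) \<le> b" "b \<le> n"
    using card insert by auto
  have "(\<Prod>i=1..Suc (card J). l i) = l (Suc (card J)) * (\<Prod>i=1..card J. l i)"
    by simp
  also have "\<dots> \<le> l b * (\<Prod>i\<in>J. l i)"
  proof (rule mult_mono)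
    show "l (Suc (card J)) \<le> l b"
      using b by (intro mono_onD[OF assms(3)]) auto
  qed (use insert b assms(4) in \<open>auto intro!: less_imp_le prod_pos\<close>)
  also have "\<dots> = (\<Prod>i\<in>insert b J. l i)"
    using insert by (subst prod.insert) auto
  finally show ?case
    using card by simp
qed simp

text \<open>The circuit found may be longer than the girth, so the bound is carried down from
  \<open>card J\<close> to \<open>g\<close>. If the factor dropped is at least \<open>r\<close>, the
  bound survives division by it; otherwise all smaller factors are below \<open>r\<close>
  too.\<close>

lemma prod_smallest_le_power:
  fixes l :: "nat \<Rightarrow> real"
  assumes J: "J \<subseteq> {1..n}" "g \<le> card J" and mono: "mono_on {1..n} l"
    and pos: "\<And>i. i \<in> {1..n} \<Longrightarrow> 0 < l i"
    and r: "(\<Prod>i\<in>J. l i) \<le> r ^ card J" "0 < r"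
  shows "(\<Prod>i=1..g. l i) \<le> r ^ g"
  using J(2)
proof (induction rule: inc_induct)
  case base
  have "finite J"
    using J(1) finite_subset by blast
  then show ?case
    using prod_initial_segment_le[OF _ J(1) mono pos] r by force
next
  case (step p)
  have "card J \<le> n"
    using card_mono[OF _ J(1)] by simp
  then have p: "Suc p \<le> n"
    using step by simp
  show ?case
  proof (cases "r \<le> l (Suc p)")
    case True
    have "r * (\<Prod>i=1..p. l i) \<le> l (Suc p) * (\<Prod>i=1..p. l i)"
      using True pos p by (intro mult_right_mono) (auto intro!: prod_nonneg intro: less_imp_le)
    also have "\<dots> \<le> r * r ^ p"
      using step by (simp add: mult.commute)
    finally show ?thesis
      using r by simp
  next
    case False
    have "(\<Prod>i=1..p. l i) \<le> (\<Prod>i=1..p. r)"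
    proof (rule prod_mono)
      fix i assume i: "i \<in> {1..p}"
      then have "l i \<le> l (Suc p)"
        using p by (intro mono_onD[OF mono]) auto
      then show "0 \<le> l i \<and> l i \<le> r"
        using False i p pos[of i] by auto
    qed
    then show ?thesis
      by simp
  qed
qed

text \<open>Reversing the order and inverting the values gives again an increasing positive
  sequence, which reduces the claim to the smallest factors.\<close>

lemma prod_largest_ge_power:
  fixes l :: "nat \<Rightarrow> real"
  assumes J: "J \<subseteq> {1..n}" "g \<le> card J" and mono: "mono_on {1..n} l"
    and pos: "\<And>i. i \<in> {1..n} \<Longrightarrow> 0 < l i"
    and r: "r ^ card J \<le> (\<Prod>i\<in>J. l i)" "0 < r"
  shows "r ^ g \<le> (\<Prod>i=n-g+1..n. l i)"
proof -
  let ?s = "\<lambda>i. n + 1 - i"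
  let ?l = "\<lambda>i. inverse (l (?s i))"
  have inj: "inj_on ?s {1..n}"
    by (auto simp: inj_on_def)
  have injJ: "inj_on ?s J"
    using inj J(1) inj_on_subset by blast
  have gn: "g \<le> n"
    using J card_mono[OF _ J(1)] by simp
  have "(\<Prod>i\<in>?s ` J. ?l i) = (\<Prod>i\<in>J. inverse (l i))"
    unfolding prod.reindex[OF injJ] comp_def using J(1) by (intro prod.cong) auto
  also have "\<dots> = inverse (\<Prod>i\<in>J. l i)"
    by (simp add: prod_inversef[unfolded comp_def])
  also have "\<dots> \<le> inverse r ^ card (?s ` J)"
    unfolding card_image[OF injJ] power_inverse using r by (intro le_imp_inverse_le) auto
  finally have "(\<Prod>i\<in>?s ` J. ?l i) \<le> inverse r ^ card (?s ` J)" .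
  moreover have "mono_on {1..n} ?l"
  proof (rule mono_onI)
    fix i j assume "i \<in> {1..n}" "j \<in> {1..n}" "i \<le> j"
    then have "?s j \<in> {1..n}" "?s i \<in> {1..n}" "?s j \<le> ?s i"
      by auto
    then show "?l i \<le> ?l j"
      using pos mono_onD[OF mono] by (intro le_imp_inverse_le) auto
  qed
  moreover have "?s ` J \<subseteq> {1..n}"
    using J(1) by force
  moreover have "0 < ?l i" if "i \<in> {1..n}" for i
  proof -
    have "?s i \<in> {1..n}"
      using that by auto
    then show ?thesis
      using pos[of "?s i"] by simp
  qed
  ultimately have "(\<Prod>i=1..g. ?l i) \<le> inverse r ^ g"
    using J(2) r(2) card_image[OF injJ]
    by (intro prod_smallest_le_power[where J = "?s ` J" and n = n]) simp_all
  moreover have "(\<Prod>i=1..g. ?l i) = inverse (\<Prod>i=n-g+1..n. l i)"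
  proof -
    have "bij_betw ?s {1..g} {n-g+1..n}"
      using gn by (intro bij_betw_byWitness[where f' = ?s]) auto
    then have "(\<Prod>i=n-g+1..n. l i) = (\<Prod>i=1..g. l (?s i))"
      by (rule prod.reindex_bij_betw[symmetric])
    then show ?thesis
      by (simp add: prod_inversef[unfolded comp_def])
  qed
  ultimately have "inverse (\<Prod>i=n-g+1..n. l i) \<le> inverse (r ^ g)"
    by (simp add: power_inverse)
  moreover have "0 < (\<Prod>i=n-g+1..n. l i)"
    using pos by (intro prod_pos) auto
  ultimately show ?thesis
    using inverse_le_imp_le by blast
qed

text \<open>Sorting the indices by slice sum gives the same list as sorting the multiset of values,
  so every position belongs to an index. This turns products over sets of vertices into products
  over positions.\<close>

lemma ordered_slice_sum_enumeration:
  fixes B :: "('n::finite, real) tensor"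
  obtains e where "bij_betw e {1..CARD('n)} (UNIV :: 'n set)"
    "\<And>i. i \<in> {1..CARD('n)} \<Longrightarrow> ordered_slice_sum m B i = slice_sum m B (e i)"
    "mono_on {1..CARD('n)} (ordered_slice_sum m B)"
proof -
  let ?s = "slice_sum m B"
  obtain us :: "'n list" where us: "set us = UNIV" "distinct us"
    using finite_distinct_list[of "UNIV :: 'n set"] by auto
  define xs where "xs = sort_key ?s us"
  have xs: "set xs = UNIV" "distinct xs" "sorted (map ?s xs)"
    using us by (auto simp: xs_def)
  then have len: "length xs = CARD('n)"
    using distinct_card[of xs] by simp
  have "mset_set (UNIV :: 'n set) = mset xs"
    using mset_set_set[of xs] xs by simp
  then have "image_mset ?s (mset_set UNIV) = mset (map ?s xs)"
    by simp
  then have "sorted_list_of_multiset (image_mset ?s (mset_set UNIV)) = map ?s xs"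
    using xs(3) by (simp only: sorted_list_of_multiset_mset sorted_sort_id)
  then have K: "ordered_slice_sum m B i = map ?s xs ! (i - 1)" for i
    by (simp add: ordered_slice_sum_def)
  \<comment> \<open>Ranks start at 1, list positions at 0.\<close>
  have "bij_betw (\<lambda>i. i - 1) {1..CARD('n)} {..<length xs}"
    by (intro bij_betw_byWitness[where f' = Suc]) (auto simp: len)
  then have "bij_betw ((!) xs \<circ> (\<lambda>i. i - 1)) {1..CARD('n)} UNIV"
    by (rule bij_betw_trans) (use xs in \<open>auto intro: bij_betw_nth\<close>)
  moreover have "ordered_slice_sum m B i = ?s (((!) xs \<circ> (\<lambda>i. i - 1)) i)" if "i \<in> {1..CARD('n)}" for i
    using that len by (auto simp: K intro!: nth_map)
  moreover have "mono_on {1..CARD('n)} (ordered_slice_sum m B)"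
  proof (rule mono_onI)
    fix i j
    assume "i \<in> {1..CARD('n)}" "j \<in> {1..CARD('n)}" "i \<le> j"
    then have "i - 1 \<le> j - 1" "j - 1 < length (map ?s xs)"
      using len by auto
    then show "ordered_slice_sum m B i \<le> ordered_slice_sum m B j"
      unfolding K by (rule sorted_nth_mono[OF xs(3)])
  qed
  ultimately show ?thesis
    using that by blast
qed

lemma ordered_slice_sum_prod_le:
  fixes B :: "('n::finite, real) tensor"
  assumes "\<And>i. 0 < slice_sum m B i" "g \<le> card S" "(\<Prod>i\<in>S. slice_sum m B i) \<le> r ^ card S" "0 < r"
  shows "(\<Prod>i=1..g. ordered_slice_sum m B i) \<le> r ^ g"
proof -
  obtain e where e: "bij_betw e {1..CARD('n)} (UNIV :: 'n set)"
    and K: "\<And>i. i \<in> {1..CARD('n)} \<Longrightarrow> ordered_slice_sum m B i = slice_sum m B (e i)"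
    and mono: "mono_on {1..CARD('n)} (ordered_slice_sum m B)"
    by (rule ordered_slice_sum_enumeration[of m B]) blast
  \<comment> \<open>The ranks of the vertices in \<open>S\<close>.\<close>
  define J where "J = {1..CARD('n)} \<inter> e -` S"
  have bij: "bij_betw e J S"
    using bij_betw_subset[OF e, of J S] bij_betw_imp_surj_on[OF e] by (force simp: J_def)
  have "(\<Prod>i\<in>J. ordered_slice_sum m B i) = (\<Prod>i\<in>J. slice_sum m B (e i))"
    using K by (intro prod.cong) (auto simp: J_def)
  also have "\<dots> = (\<Prod>i\<in>S. slice_sum m B i)"
    by (rule prod.reindex_bij_betw[OF bij])
  finally show ?thesis
    using assms K bij_betw_same_card[OF bij]
    by (intro prod_smallest_le_power[where J = J and n = "CARD('n)"] mono) (auto simp: J_def)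
qed

lemma ordered_slice_sum_prod_ge:
  fixes B :: "('n::finite, real) tensor"
  assumes "\<And>i. 0 < slice_sum m B i" "g \<le> card S" "r ^ card S \<le> (\<Prod>i\<in>S. slice_sum m B i)" "0 < r"
  shows "r ^ g \<le> (\<Prod>i=CARD('n)-g+1..CARD('n). ordered_slice_sum m B i)"
proof -
  obtain e where e: "bij_betw e {1..CARD('n)} (UNIV :: 'n set)"
    and K: "\<And>i. i \<in> {1..CARD('n)} \<Longrightarrow> ordered_slice_sum m B i = slice_sum m B (e i)"
    and mono: "mono_on {1..CARD('n)} (ordered_slice_sum m B)"
    by (rule ordered_slice_sum_enumeration[of m B]) blast
  define J where "J = {1..CARD('n)} \<inter> e -` S"
  have bij: "bij_betw e J S"
    using bij_betw_subset[OF e, of J S] bij_betw_imp_surj_on[OF e] by (force simp: J_def)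
  have "(\<Prod>i\<in>J. ordered_slice_sum m B i) = (\<Prod>i\<in>J. slice_sum m B (e i))"
    using K by (intro prod.cong) (auto simp: J_def)
  also have "\<dots> = (\<Prod>i\<in>S. slice_sum m B i)"
    by (rule prod.reindex_bij_betw[OF bij])
  finally show ?thesis
    using assms K bij_betw_same_card[OF bij]
    by (intro prod_largest_ge_power[where J = J] mono) (auto simp: J_def)
qed

section \<open>Both extremal characterisations of the spectral radius\<close>

theorem theorem3p7:
  fixes A :: "('n::finite, real) tensor" and m g :: nat
  defines "n \<equiv> CARD('n)"
    and "K \<equiv> (\<lambda>X. ordered_slice_sum m (diagonal_scaling m X A))"
    and "\<rho> \<equiv> tensor_spectral_radius m (\<lambda>idx. complex_of_real (A idx))"
  assumes "nonneg_tensor m A"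
    and "weakly_irreducible m A"
    and "girth (tensor_digraph m A) = enat g"
  shows "(\<exists>X\<in>positive_diagonal_matrices. root g (\<Prod>i=n-g+1..n. K X i) = \<rho>) \<and>
         (\<forall>X\<in>positive_diagonal_matrices. \<rho> \<le> root g (\<Prod>i=n-g+1..n. K X i)) \<and>
         (\<exists>X\<in>positive_diagonal_matrices. root g (\<Prod>i=1..g. K X i) = \<rho>) \<and>
         (\<forall>X\<in>positive_diagonal_matrices. root g (\<Prod>i=1..g. K X i) \<le> \<rho>)"
proof -
  note A = assms(4) and irr = assms(5) and g = assms(6)
  let ?s = "\<lambda>X. slice_sum m (diagonal_scaling m X A)"
  obtain y r where y: "\<And>i. 0 < y i" and eig: "\<And>i. tensor_form m A y i = r * y i ^ (m - 1)"
    using positive_eigenvector[OF A irr] by blast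
  have \<rho>: "\<rho> = r"
    unfolding \<rho>_def by (rule spectral_radius_eq_positive_eigenvalue[OF A y eig])
  have form_pos: "0 < tensor_form m A x i" if "\<And>j. 0 < x j" for x i
    using weakly_irreducible_out_arc[OF irr g, of i] tensor_form_pos[OF A, of x] that by blast
  have "0 < r * y undefined ^ (m - 1)"
    using form_pos[of y undefined] y eig by simp
  then have r: "0 < r"
    using y[of undefined] by (simp add: zero_less_mult_iff)
  have g0: "0 < g"
    using girth_tensor_digraph_pos[OF g] .
  \<comment> \<open>Only the size of \<open>S\<close> matters here: a set of at least
    \<open>g\<close> vertices shows \<open>g \<le> n\<close>, so that \<open>n - g\<close> is not
    truncated and the upper product has exactly \<open>g\<close> factors.\<close>
  obtain S :: "'n set" where "g \<le> card S"
    using cycle_slice_prod_le[OF A irr g y eig y] .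
  then have gn: "g \<le> n"
    using card_mono[of UNIV S] by (simp add: n_def)

  have slice_pos: "0 < ?s X i" if "X \<in> positive_diagonal_matrices" for X i
    using that form_pos[of "\<lambda>j. X $ j $ j" i]
    by (simp add: slice_sum_diagonal_scaling positive_diagonal_matrices_def)
  have upper: "r \<le> root g (\<Prod>i=n-g+1..n. K X i)" if X: "X \<in> positive_diagonal_matrices" for X
  proof -
    have x: "\<And>i. 0 < X $ i $ i"
      using X by (simp add: positive_diagonal_matrices_def)
    obtain S where "g \<le> card S" "r ^ card S \<le> (\<Prod>i\<in>S. ?s X i)"
      unfolding slice_sum_diagonal_scaling
      by (rule cycle_slice_prod_ge[OF A irr g y eig x less_imp_le[OF r]])
    then have "r ^ g \<le> (\<Prod>i=n-g+1..n. K X i)"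
      unfolding n_def K_def using slice_pos[OF X] r by (intro ordered_slice_sum_prod_ge) auto
    then have "root g (r ^ g) \<le> root g (\<Prod>i=n-g+1..n. K X i)"
      using g0 by simp
    then show ?thesis
      using r g0 by (simp add: real_root_power_cancel)
  qed
  have lower: "root g (\<Prod>i=1..g. K X i) \<le> r" if X: "X \<in> positive_diagonal_matrices" for X
  proof -
    have x: "\<And>i. 0 < X $ i $ i"
      using X by (simp add: positive_diagonal_matrices_def)
    obtain S where "g \<le> card S" "(\<Prod>i\<in>S. ?s X i) \<le> r ^ card S"
      unfolding slice_sum_diagonal_scaling
      by (rule cycle_slice_prod_le[OF A irr g y eig x])
    then have "(\<Prod>i=1..g. K X i) \<le> r ^ g"
      unfolding K_def using slice_pos[OF X] r by (intro ordered_slice_sum_prod_le) auto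
    then have "root g (\<Prod>i=1..g. K X i) \<le> root g (r ^ g)"
      using g0 by simp
    then show ?thesis
      using r g0 by (simp add: real_root_power_cancel)
  qed

  \<comment> \<open>Scaling by the positive eigenvector makes all slice sums equal to
    \<open>r\<close>, so this one matrix attains both extrema.\<close>
  define Y :: "real ^ 'n ^ 'n" where "Y = (\<chi> i j. if i = j then y i else 0)"
  have Y: "Y \<in> positive_diagonal_matrices"
    using y by (simp add: Y_def positive_diagonal_matrices_def)
  have sY: "?s Y i = r" for i
    using y[of i] by (simp add: slice_sum_diagonal_scaling Y_def eig)
  have KY: "K Y i = r" if i: "i \<in> {1..n}" for i
    using ordered_slice_sum_enumeration[of m "diagonal_scaling m Y A"] i sY
    unfolding K_def n_def by metis
  have "(\<Prod>i=n-g+1..n. K Y i) = (\<Prod>i=n-g+1..n. r)" "(\<Prod>i=1..g. K Y i) = (\<Prod>i=1..g. r)"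
    using KY gn by (auto intro!: prod.cong)
  then have "root g (\<Prod>i=n-g+1..n. K Y i) = r" "root g (\<Prod>i=1..g. K Y i) = r"
    using gn g0 r by (auto simp: real_root_power_cancel)
  then show ?thesis
    using Y upper lower unfolding \<rho> by blast
qed

end
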